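(* Let $k\in\mathbb{N}$. Let $G$ be a group, and let $M=(\mu_n)_{n=1}^\infty$ be a sequence of probability measures on $G$ that measures index uniformly. Then $P_M^k(G,1)\ge P_M^k(G,g)$ for every $g\in G$.
   Context: Groups are discrete. Simple commutators are defined by $[x_1,x_2]=x_1^{-1}x_2^{-1}x_1x_2$ and $[x_1,\ldots,x_k]=[[x_1,\ldots,x_{k-1}],x_k]$. For a probability measure $\mu$ on $G$ and $g\in G$, $P^k_\mu(G,g)$ is the probability that $[x_1,\ldots,x_{k+1}]=g$ when $x_1,\ldots,x_{k+1}$ are chosen independently according to $\mu$ (i.e. the product measure of the set of such tuples in $G^{k+1}$). For a sequence $M=(\mu_n)_{n=1}^\infty$ of probability measures, $P_M^k(G,g)=\limsup_{n\to\infty}P_{\mu_n}^k(G,g)$. The sequence $M$ measures index uniformly if $\mu_n(xH)\to1/[G:H]$ as $n\to\infty$, uniformly over all $x\in G$ and all subgroups $H$ of $G$, where $1/[G:H]=0$ if $[G:H]=\infty$. *)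

theory Defs
  imports "HOL-Probability.Probability" "HOL-Algebra.Left_Coset"
begin

definition commutator :: "('a, 'b) monoid_scheme \<Rightarrow> 'a \<Rightarrow> 'a \<Rightarrow> 'a" where
  "commutator G x y = inv\<^bsub>G\<^esub> x \<otimes>\<^bsub>G\<^esub> inv\<^bsub>G\<^esub> y \<otimes>\<^bsub>G\<^esub> x \<otimes>\<^bsub>G\<^esub> y"

text \<open>\<open>simple_commutator G k x\<close> is the simple commutator of the \<open>k + 1\<close> entries
  \<open>x 0, \<dots>, x k\<close>; for \<open>k = 0\<close> it is \<open>x 0\<close>.\<close>

fun simple_commutator :: "('a, 'b) monoid_scheme \<Rightarrow> nat \<Rightarrow> (nat \<Rightarrow> 'a) \<Rightarrow> 'a" where
  "simple_commutator G 0 x = x 0"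
| "simple_commutator G (Suc k) x = commutator G (simple_commutator G k x) (x (Suc k))"

text \<open>As groups are discrete, a probability measure on \<open>G\<close> is defined on all subsets of \<open>G\<close>
  (this also fixes the underlying space to be \<open>carrier G\<close>).\<close>

definition group_prob_measure :: "('a, 'b) monoid_scheme \<Rightarrow> 'a measure \<Rightarrow> bool" where
  "group_prob_measure G \<mu> \<longleftrightarrow> prob_space \<mu> \<and> sets \<mu> = Pow (carrier G)"

definition tuple_measure :: "nat \<Rightarrow> 'a measure \<Rightarrow> (nat \<Rightarrow> 'a) measure" where
  "tuple_measure k \<mu> = completion (\<Pi>\<^sub>M i\<in>{..k}. \<mu>)"

definition comm_tuples :: "('a, 'b) monoid_scheme \<Rightarrow> nat \<Rightarrow> 'a \<Rightarrow> (nat \<Rightarrow> 'a) set" where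
  "comm_tuples G k g = {x \<in> {..k} \<rightarrow>\<^sub>E carrier G. simple_commutator G k x = g}"

definition comm_prob :: "('a, 'b) monoid_scheme \<Rightarrow> nat \<Rightarrow> 'a measure \<Rightarrow> 'a \<Rightarrow> real" where
  "comm_prob G k \<mu> g = measure (tuple_measure k \<mu>) (comm_tuples G k g)"

text \<open>The probability that a simple commutator equals \<open>g\<close> only makes sense if the set of such
  tuples is measurable for the product measure. The product of two full power set sigma-algebras
  can be smaller than the power set of the product (if \<open>G\<close> has more than continuum many
  elements), so this is not automatic. By \<open>comm_probs_defined_countable_support\<close>
  below it holds whenever the measure is concentrated on a countable set, so in particular for
  every probability measure on a countable group and for every measure given by point masses.\<close>

definition comm_probs_defined :: "('a, 'b) monoid_scheme \<Rightarrow> nat \<Rightarrow> 'a measure \<Rightarrow> bool" where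
  "comm_probs_defined G k \<mu> \<longleftrightarrow>
     (\<forall>g\<in>carrier G. comm_tuples G k g \<in> sets (tuple_measure k \<mu>))"

definition limsup_comm_prob ::
    "('a, 'b) monoid_scheme \<Rightarrow> nat \<Rightarrow> (nat \<Rightarrow> 'a measure) \<Rightarrow> 'a \<Rightarrow> ereal" where
  "limsup_comm_prob G k M g = limsup (\<lambda>n. ereal (comm_prob G k (M n) g))"

definition inverse_index :: "('a, 'b) monoid_scheme \<Rightarrow> 'a set \<Rightarrow> real" where
  "inverse_index G H =
     (if finite (lcosets\<^bsub>G\<^esub> H) then 1 / real (card (lcosets\<^bsub>G\<^esub> H)) else 0)"

definition measures_index_uniformly ::
    "('a, 'b) monoid_scheme \<Rightarrow> (nat \<Rightarrow> 'a measure) \<Rightarrow> bool" where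
  "measures_index_uniformly G M \<longleftrightarrow>
     uniform_limit {(x, H). x \<in> carrier G \<and> subgroup H G}
       (\<lambda>n (x, H). measure (M n) (x <#\<^bsub>G\<^esub> H))
       (\<lambda>(x, H). inverse_index G H) sequentially"

lemma comm_probs_defined_countable_support:
  assumes \<mu>: "group_prob_measure G \<mu>"
    and S: "countable S" "S \<subseteq> carrier G" "measure \<mu> S = 1"
  shows "comm_probs_defined G k \<mu>"
  unfolding comm_probs_defined_def
proof
  fix g assume "g \<in> carrier G"
  let ?P = "\<Pi>\<^sub>M i\<in>{..k}. \<mu>"
  let ?A = "comm_tuples G k g"
  let ?S = "{..k} \<rightarrow>\<^sub>E S"
  have sets: "sets \<mu> = Pow (carrier G)" and p: "prob_space \<mu>"
    using \<mu> by (auto simp: group_prob_measure_def)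
  have space: "space \<mu> = carrier G"
    using sets.top[of \<mu>] sets.sets_into_space[of "carrier G" \<mu>] sets by auto
  interpret prob_space \<mu> by (rule p)
  interpret P: product_prob_space "\<lambda>_. \<mu>" "{..k}" by unfold_locales
  interpret PF: finite_product_prob_space "\<lambda>_. \<mu>" "{..k}" by unfold_locales simp
  have Ssets: "?S \<in> sets ?P"
    using S sets by (intro sets_PiM_I_finite) auto
  have "measure ?P ?S = (\<Prod>i\<in>{..k}. measure \<mu> S)"
    using S sets by (intro PF.prob_times) auto
  then have "measure ?P ?S = 1" by (simp add: S)
  then have "measure ?P (space ?P - ?S) = 0"
    using P.prob_compl[OF Ssets] by simp
  then have null: "space ?P - ?S \<in> null_sets ?P"
    using Ssets by (auto simp: null_sets_def P.emeasure_eq_measure)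
  have "countable ?S" using S by (intro countable_PiE) auto
  then have "countable (?A \<inter> ?S)" by (rule countable_subset[rotated]) auto
  moreover have "{x} \<in> sets ?P" if x: "x \<in> ?A \<inter> ?S" for x
  proof -
    have "{x} = (\<Pi>\<^sub>E i\<in>{..k}. {x i})"
      using x by (intro PiE_singleton[symmetric]) (auto simp: PiE_def)
    also have "\<dots> \<in> sets ?P"
      using x S sets by (intro sets_PiM_I_finite) auto
    finally show ?thesis .
  qed
  ultimately have 1: "?A \<inter> ?S \<in> sets ?P"
    by (rule sets.countable[rotated])
  have sub: "?A - ?S \<subseteq> space ?P - ?S"
    by (auto simp: comm_tuples_def space_PiM space)
  have "?A = (?A \<inter> ?S) \<union> (?A - ?S)" by auto
  then have "?A \<in> sets (completion ?P)"
    using sets_completionI[OF _ sub null 1] by blast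
  then show "?A \<in> sets (tuple_measure k \<mu>)" by (simp add: tuple_measure_def)
qed

end

theory Submission
  imports Defs
begin

text \<open>For \<open>c = [x\<^sub>0, \<dots>, x\<^sub>k\<^sub>-\<^sub>1]\<close> fixed, the solutions \<open>y\<close> of \<open>[c, y] = g\<close> form either the empty set or a
  right coset of the centraliser of \<open>c\<close>, and for \<open>g = 1\<close> they form the centraliser itself. A right
  coset of \<open>H\<close> is a left coset of a conjugate of \<open>H\<close>, which has the same index, so up to an error
  that is uniform in \<open>c\<close> the fibre over \<open>1\<close> is at least as large as the fibre over \<open>g\<close>. Integrating
  over \<open>x\<^sub>0, \<dots>, x\<^sub>k\<^sub>-\<^sub>1\<close> gives the claim.\<close>

section \<open>Centralisers and the fibres of the commutator map\<close>

definition centralizer :: "('a, 'b) monoid_scheme \<Rightarrow> 'a \<Rightarrow> 'a set" where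
  "centralizer G c = {h \<in> carrier G. c \<otimes>\<^bsub>G\<^esub> h = h \<otimes>\<^bsub>G\<^esub> c}"

context group
begin

lemma subgroup_centralizer:
  assumes c: "c \<in> carrier G"
  shows "subgroup (centralizer G c) G"
proof
  show "inv x \<in> centralizer G c" if "x \<in> centralizer G c" for x
  proof -
    have x: "x \<in> carrier G" "c \<otimes> x = x \<otimes> c"
      using that by (auto simp: centralizer_def)
    have "inv x \<otimes> (c \<otimes> x) \<otimes> inv x = inv x \<otimes> (x \<otimes> c) \<otimes> inv x"
      using x by simp
    moreover have "inv x \<otimes> (c \<otimes> x) \<otimes> inv x = inv x \<otimes> c"
      using x(1) c by (simp add: m_assoc)
    moreover have "inv x \<otimes> (x \<otimes> c) \<otimes> inv x = c \<otimes> inv x"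
      using x(1) c by (simp add: m_assoc[symmetric])
    ultimately have "c \<otimes> inv x = inv x \<otimes> c" by simp
    then show ?thesis
      using x by (simp add: centralizer_def)
  qed
  show "x \<otimes> y \<in> centralizer G c"
    if "x \<in> centralizer G c" "y \<in> centralizer G c" for x y
    using that c by (auto simp: centralizer_def) (metis m_assoc)
qed (use c in \<open>auto simp: centralizer_def\<close>)

lemma commutator_closed [simp, intro]:
  "x \<in> carrier G \<Longrightarrow> y \<in> carrier G \<Longrightarrow> commutator G x y \<in> carrier G"
  by (simp add: commutator_def)

lemma simple_commutator_closed:
  "(\<And>i. i \<le> k \<Longrightarrow> x i \<in> carrier G) \<Longrightarrow> simple_commutator G k x \<in> carrier G"
  by (induction k) auto

text \<open>Cancelling \<open>inv c\<close> leaves equality of the conjugates of \<open>c\<close> by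
  \<open>y\<close> and by \<open>z\<close>; multiplying by \<open>y\<close> on the left and by
  \<open>inv z\<close> on the right turns this into commutation of \<open>c\<close> with
  \<open>y \<otimes> inv z\<close>.\<close>

lemma commutator_eq_iff:
  assumes c: "c \<in> carrier G" and y: "y \<in> carrier G" and z: "z \<in> carrier G"
  shows "commutator G c y = commutator G c z \<longleftrightarrow> y \<otimes> inv z \<in> centralizer G c"
proof -
  have "commutator G c y = commutator G c z \<longleftrightarrow> inv y \<otimes> c \<otimes> y = inv z \<otimes> c \<otimes> z"
    using c y z by (simp add: commutator_def m_assoc)
  also have "\<dots> \<longleftrightarrow> y \<otimes> (inv y \<otimes> c \<otimes> y) \<otimes> inv z = y \<otimes> (inv z \<otimes> c \<otimes> z) \<otimes> inv z"
    using c y z by simp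
  also have "y \<otimes> (inv y \<otimes> c \<otimes> y) \<otimes> inv z = c \<otimes> (y \<otimes> inv z)"
    using c y z by (simp add: m_assoc[symmetric])
  also have "y \<otimes> (inv z \<otimes> c \<otimes> z) \<otimes> inv z = (y \<otimes> inv z) \<otimes> c"
    using c y z by (simp add: m_assoc)
  finally show ?thesis
    using y z by (simp add: centralizer_def)
qed

lemma commutator_fibre:
  assumes c: "c \<in> carrier G" and z: "z \<in> carrier G"
  shows "{y \<in> carrier G. commutator G c y = commutator G c z} = centralizer G c #> z"
proof -
  interpret C: subgroup "centralizer G c" G
    by (rule subgroup_centralizer[OF c])
  have "y \<in> centralizer G c #> z \<longleftrightarrow> y \<otimes> inv z \<in> centralizer G c" if "y \<in> carrier G" for y
    using C.rcos_module[OF is_group z that] .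
  moreover have "centralizer G c #> z \<subseteq> carrier G"
    using z C.subset by (rule r_coset_subset_G[rotated])
  ultimately show ?thesis
    using commutator_eq_iff[OF c _ z] by blast
qed

section \<open>Conjugate subgroups and their index\<close>

lemma subgroup_conjugate:
  assumes H: "subgroup H G" and y: "y \<in> carrier G"
  shows "subgroup (inv y <# H #> y) G"
proof -
  interpret subgroup H G by (rule H)
  have eq: "inv y <# H #> y = (\<lambda>h. inv y \<otimes> h \<otimes> y) ` H"
    by (auto simp: l_coset_def r_coset_def)
  have cancel: "y \<otimes> (inv y \<otimes> a) = a" if "a \<in> carrier G" for a
    using y that by (simp add: m_assoc[symmetric])
  have "inv y \<otimes> h \<otimes> y \<otimes> (inv y \<otimes> h' \<otimes> y) = inv y \<otimes> (h \<otimes> h') \<otimes> y"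
    if "h \<in> H" "h' \<in> H" for h h'
    using y that by (simp add: m_assoc cancel)
  then have "inv y \<otimes> h \<otimes> y \<otimes> (inv y \<otimes> h' \<otimes> y) \<in> (\<lambda>h. inv y \<otimes> h \<otimes> y) ` H"
    if "h \<in> H" "h' \<in> H" for h h'
    using that by auto
  moreover have "inv (inv y \<otimes> h \<otimes> y) = inv y \<otimes> inv h \<otimes> y" if "h \<in> H" for h
    using y that by (simp add: inv_mult_group m_assoc)
  moreover have "H \<noteq> {}" using subgroup.one_closed[OF H] by blast
  ultimately show ?thesis
    unfolding eq using y
    by (intro subgroupI) auto
qed

text \<open>Since \<open>a <# (inv y <# H #> y) = ((a \<otimes> inv y) <# H) #> y\<close> and
  \<open>a \<otimes> inv y\<close> runs through the whole group with \<open>a\<close>, right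
  translation by \<open>y\<close> is a bijection from the left cosets of \<open>H\<close> onto those
  of the conjugate. This settles finite and infinite index at once.\<close>

lemma inverse_index_conjugate:
  assumes H: "subgroup H G" and y: "y \<in> carrier G"
  shows "inverse_index G (inv y <# H #> y) = inverse_index G H"
proof -
  interpret subgroup H G by (rule H)
  have coset: "a <# (inv y <# H #> y) = ((a \<otimes> inv y) <# H) #> y" if "a \<in> carrier G" for a
    using that y by (simp add: coset_assoc l_coset_subset_G subset lcos_m_assoc)
  have surj: "(\<lambda>a. a \<otimes> inv y) ` carrier G = carrier G"
  proof -
    have "a = (a \<otimes> y) \<otimes> inv y" if "a \<in> carrier G" for a
      using that y by (simp add: m_assoc)
    then show ?thesis using y by (auto intro: rev_image_eqI)
  qed
  have lcosets: "lcosets K = (\<lambda>a. a <# K) ` carrier G" for K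
    by (auto simp: LCOSETS_def)
  have "lcosets (inv y <# H #> y) = (\<lambda>a. (a <# H) #> y) ` (\<lambda>a. a \<otimes> inv y) ` carrier G"
    unfolding lcosets image_image using coset by (rule image_cong[OF refl])
  then have img: "lcosets (inv y <# H #> y) = (\<lambda>A. A #> y) ` (lcosets H)"
    by (simp only: surj lcosets image_image)
  have inj: "inj_on (\<lambda>A. A #> y) (lcosets H)"
  proof (rule inj_on_inverseI)
    fix A assume "A \<in> lcosets H"
    then have "A \<subseteq> carrier G" using lcosets_carrier[OF is_group] by blast
    then show "A #> y #> inv y = A" using y by (simp add: coset_mult_assoc)
  qed
  show ?thesis
    by (simp add: inverse_index_def img card_image[OF inj] finite_image_iff[OF inj])
qed

section \<open>Fibre estimates for a single measure\<close>

text \<open>Uniformity over all subgroups matters here: \<open>close\<close> speaks of left cosets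
  only, but it applies with the same \<open>e\<close> to the conjugate of \<open>H\<close> by any
  \<open>y\<close>.\<close>

lemma measure_r_coset_close:
  assumes close: "\<And>x H. x \<in> carrier G \<Longrightarrow> subgroup H G \<Longrightarrow>
      \<bar>measure \<mu> (x <# H) - inverse_index G H\<bar> < e"
    and H: "subgroup H G" and y: "y \<in> carrier G"
  shows "\<bar>measure \<mu> (H #> y) - inverse_index G H\<bar> < e"
proof -
  interpret subgroup H G by (rule H)
  have "y <# (inv y <# H #> y) = H #> y"
    using y by (simp add: coset_assoc l_coset_subset_G subset lcos_m_assoc lcos_mult_one)
  then show ?thesis
    using close[OF y subgroup_conjugate[OF H y]] by (simp add: inverse_index_conjugate[OF H y])
qed

text \<open>A nonempty fibre over \<open>g\<close> and the fibre over \<open>\<one>\<close> are both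
  within \<open>e\<close> of the same inverse index, whence the \<open>2 * e\<close>.\<close>

lemma measure_commutator_fibre_le:
  assumes close: "\<And>x H. x \<in> carrier G \<Longrightarrow> subgroup H G \<Longrightarrow>
      \<bar>measure \<mu> (x <# H) - inverse_index G H\<bar> < e"
    and c: "c \<in> carrier G"
  shows "measure \<mu> {y \<in> carrier G. commutator G c y = g} \<le>
    measure \<mu> {y \<in> carrier G. commutator G c y = \<one>} + 2 * e"
proof (cases "\<exists>z\<in>carrier G. commutator G c z = g")
  case True
  then obtain z where z: "z \<in> carrier G" and g: "g = commutator G c z" by auto
  \<comment> \<open>This makes the fibre over \<open>\<one>\<close> the coset through
    \<open>z = \<one>\<close>, so that \<open>commutator_fibre\<close> covers both fibres.\<close>
  have one: "commutator G c \<one> = \<one>" using c by (simp add: commutator_def)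
  show ?thesis
    using measure_r_coset_close[OF close subgroup_centralizer[OF c] z]
      measure_r_coset_close[OF close subgroup_centralizer[OF c] one_closed]
      commutator_fibre[OF c z] commutator_fibre[OF c one_closed]
    by (simp add: g one)
next
  case False
  then have empty: "{y \<in> carrier G. commutator G c y = g} = {}" by auto
  \<comment> \<open>Any instance of \<open>close\<close> bounds an absolute value strictly by
    \<open>e\<close>.\<close>
  have "0 < e" using close[OF one_closed subgroup_self] by linarith
  then show ?thesis by (simp only: empty) simp
qed

text \<open>This serves the case \<open>k = 0\<close>, where the commutator is a single entry:
  points are the cosets of the trivial subgroup.\<close>

lemma measure_point_le:
  assumes close: "\<And>x H. x \<in> carrier G \<Longrightarrow> subgroup H G \<Longrightarrow>
      \<bar>measure \<mu> (x <# H) - inverse_index G H\<bar> < e"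
    and g: "g \<in> carrier G"
  shows "measure \<mu> {g} \<le> measure \<mu> {\<one>} + 2 * e"
proof -
  have "x <# {\<one>} = {x}" if "x \<in> carrier G" for x
    using that by (simp add: l_coset_def)
  then show ?thesis
    using close[OF g triv_subgroup] close[OF one_closed triv_subgroup] g by simp
qed

end

section \<open>Integrating fibre estimates over the completed product\<close>

text \<open>The measures of the fibres need not be measurable in \<open>x\<close> when \<open>A\<close> and \<open>B\<close> are measurable only for the
  completion, so \<open>A\<close> is approximated from inside and \<open>B\<close> from outside before integrating.\<close>

lemma measure_completion_PiM_insert_le:
  assumes \<mu>: "prob_space \<mu>" and I: "finite I" "i \<notin> I" and e: "0 \<le> e"
    and A: "A \<in> sets (completion (PiM (insert i I) (\<lambda>_. \<mu>)))"
    and B: "B \<in> sets (completion (PiM (insert i I) (\<lambda>_. \<mu>)))"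
    and sets: "sets \<mu> = Pow (space \<mu>)"
    and fibres: "\<And>x. x \<in> I \<rightarrow>\<^sub>E space \<mu> \<Longrightarrow>
      measure \<mu> {y \<in> space \<mu>. x(i := y) \<in> A} \<le> measure \<mu> {y \<in> space \<mu>. x(i := y) \<in> B} + e"
  shows "measure (completion (PiM (insert i I) (\<lambda>_. \<mu>))) A \<le>
    measure (completion (PiM (insert i I) (\<lambda>_. \<mu>))) B + e"
proof -
  let ?J = "PiM (insert i I) (\<lambda>_. \<mu>)" and ?I = "PiM I (\<lambda>_. \<mu>)"
  interpret prob_space \<mu> by (rule \<mu>)
  have psf: "product_sigma_finite (\<lambda>_. \<mu>)"
    by (simp add: product_sigma_finite_def sigma_finite_measure_axioms)
  have I1: "emeasure ?I (space ?I) = 1"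
    by (intro prob_space.emeasure_space_1 prob_space_PiM \<mu>)
  have "prob_space (completion ?J)"
    by (intro prob_space.prob_space_completion prob_space_PiM \<mu>)
  then have C: "finite_measure (completion ?J)"
    by (rule prob_space.finite_measure)
  obtain B' where B': "B' \<in> sets ?J" "B \<subseteq> B'" "emeasure (completion ?J) B = emeasure ?J B'"
    by (rule completion_upper[OF B])
  define A' where "A' = main_part ?J A"
  have A': "A' \<in> sets ?J" and emA: "emeasure (completion ?J) A = emeasure ?J A'"
    unfolding A'_def by (rule main_part_sets[OF A], rule emeasure_completion[OF A])
  have A'_sub: "A' \<subseteq> A"
    unfolding A'_def by (subst (2) main_part_null_part_Un[OF A, symmetric]) (rule Un_upper1)
  \<comment> \<open>Fubini, with coordinate \<open>i\<close> integrated first.\<close>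
  have fib: "emeasure ?J S = (\<integral>\<^sup>+ x. emeasure \<mu> {y \<in> space \<mu>. x(i := y) \<in> S} \<partial>?I)"
    if S: "S \<in> sets ?J" for S
  proof -
    have "emeasure ?J S = (\<integral>\<^sup>+ x. indicator S x \<partial>?J)" using S by simp
    also have "\<dots> = (\<integral>\<^sup>+ x. (\<integral>\<^sup>+ y. indicator S (x(i := y)) \<partial>\<mu>) \<partial>?I)"
      using S I by (intro product_sigma_finite.product_nn_integral_insert[OF psf]) auto
    also have "\<dots> = (\<integral>\<^sup>+ x. emeasure \<mu> {y \<in> space \<mu>. x(i := y) \<in> S} \<partial>?I)"
    proof (intro nn_integral_cong)
      fix x
      have "(\<integral>\<^sup>+ y. indicator S (x(i := y)) \<partial>\<mu>) =
          (\<integral>\<^sup>+ y. indicator {y \<in> space \<mu>. x(i := y) \<in> S} y \<partial>\<mu>)"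
        by (intro nn_integral_cong) (simp add: indicator_def)
      then show "(\<integral>\<^sup>+ y. indicator S (x(i := y)) \<partial>\<mu>) =
          emeasure \<mu> {y \<in> space \<mu>. x(i := y) \<in> S}"
        by (simp add: sets)
    qed
    finally show ?thesis .
  qed
  \<comment> \<open>Measurability in \<open>x\<close> allows the integral of the sum to be split
    below. The section at \<open>x\<close> of the preimage \<open>?Q\<close> is the fibre of
    \<open>B'\<close>.\<close>
  have meas: "(\<lambda>x. emeasure \<mu> {y \<in> space \<mu>. x(i := y) \<in> B'}) \<in> borel_measurable ?I"
  proof -
    let ?Q = "(\<lambda>(f, y). f(i := y)) -` B' \<inter> space (?I \<Otimes>\<^sub>M \<mu>)"
    have "?Q \<in> sets (?I \<Otimes>\<^sub>M \<mu>)"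
      using measurable_add_dim B'(1) by (rule measurable_sets)
    then have "(\<lambda>x. emeasure \<mu> (Pair x -` ?Q)) \<in> borel_measurable ?I"
      by (rule measurable_emeasure_Pair)
    moreover have "Pair x -` ?Q = {y \<in> space \<mu>. x(i := y) \<in> B'}" if "x \<in> space ?I" for x
      using that by (auto simp: space_pair_measure)
    then have "(\<lambda>x. emeasure \<mu> (Pair x -` ?Q)) \<in> borel_measurable ?I \<longleftrightarrow> ?thesis"
      by (intro measurable_cong) (simp only:)
    ultimately show ?thesis by (rule iffD1[rotated])
  qed
  have "emeasure ?J A' \<le> (\<integral>\<^sup>+ x. emeasure \<mu> {y \<in> space \<mu>. x(i := y) \<in> B'} + ennreal e \<partial>?I)"
    unfolding fib[OF A']
  proof (intro nn_integral_mono)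
    fix x assume "x \<in> space ?I"
    then have x: "x \<in> I \<rightarrow>\<^sub>E space \<mu>" by (simp add: space_PiM)
    \<comment> \<open>Each single fibre of \<open>A\<close> and \<open>B\<close> is an event by
      \<open>sets\<close>, so the chain can pass from \<open>A'\<close> through \<open>A\<close> and
      \<open>B\<close> to \<open>B'\<close> pointwise in \<open>x\<close>.\<close>
    have "measure \<mu> {y \<in> space \<mu>. x(i := y) \<in> A'} \<le> measure \<mu> {y \<in> space \<mu>. x(i := y) \<in> A}"
      using A'_sub by (intro finite_measure_mono) (auto simp: sets)
    also note fibres[OF x]
    also have "measure \<mu> {y \<in> space \<mu>. x(i := y) \<in> B} \<le> measure \<mu> {y \<in> space \<mu>. x(i := y) \<in> B'}"
      using B'(2) by (intro finite_measure_mono) (auto simp: sets)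
    finally show "emeasure \<mu> {y \<in> space \<mu>. x(i := y) \<in> A'} \<le>
        emeasure \<mu> {y \<in> space \<mu>. x(i := y) \<in> B'} + ennreal e"
      using e by (simp add: emeasure_eq_measure ennreal_plus[symmetric] del: ennreal_plus)
  qed
  \<comment> \<open>The constant integrates to itself because \<open>?I\<close> has total mass
    1.\<close>
  also have "\<dots> = emeasure ?J B' + ennreal e"
    using meas by (simp add: nn_integral_add fib[OF B'(1)] I1)
  finally have "emeasure (completion ?J) A \<le> emeasure (completion ?J) B + ennreal e"
    by (simp only: emA B'(3))
  then show ?thesis
    using e by (simp add: finite_measure.emeasure_eq_measure[OF C] ennreal_plus[symmetric] del: ennreal_plus emeasure_completion)
qed

section \<open>Comparison of commutator probabilities and passage to the limit superior\<close>

lemma comm_prob_le: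
  fixes G (structure)
  assumes G: "group G" and \<mu>: "group_prob_measure G \<mu>" and def: "comm_probs_defined G k \<mu>"
    and close: "\<And>x H. x \<in> carrier G \<Longrightarrow> subgroup H G \<Longrightarrow>
      \<bar>measure \<mu> (x <# H) - inverse_index G H\<bar> < e"
    and g: "g \<in> carrier G"
  shows "comm_prob G k \<mu> g \<le> comm_prob G k \<mu> \<one> + 2 * e"
proof -
  interpret group G by (rule G)
  have prob: "prob_space \<mu>" and sets: "sets \<mu> = Pow (carrier G)"
    using \<mu> by (auto simp: group_prob_measure_def)
  have space: "space \<mu> = carrier G"
    using sets by (metis Pow_top cSup_eq_maximum PowD sets.sets_into_space sets.top subset_antisym)
  \<comment> \<open>The last entry is split off as the fibre variable; for \<open>k = 0\<close> no
    other coordinates remain.\<close>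
  have J: "{..k} = insert k {..<k}" by auto
  have e: "0 \<le> 2 * e" using close[OF one_closed subgroup_self] by linarith
  have def': "comm_tuples G k h \<in> sets (completion (PiM (insert k {..<k}) (\<lambda>_. \<mu>)))"
    if "h \<in> carrier G" for h
    using def that by (simp add: comm_probs_defined_def tuple_measure_def J)
  have "measure \<mu> {y \<in> space \<mu>. x(k := y) \<in> comm_tuples G k g} \<le>
      measure \<mu> {y \<in> space \<mu>. x(k := y) \<in> comm_tuples G k \<one>} + 2 * e"
    if x: "x \<in> {..<k} \<rightarrow>\<^sub>E space \<mu>" for x
  proof -
    have mem: "x(k := y) \<in> {..k} \<rightarrow>\<^sub>E carrier G" if "y \<in> carrier G" for y
      using x that unfolding J space by (rule PiE_fun_upd[rotated])
    show ?thesis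
    proof (cases k)
      case 0
      have "{y \<in> space \<mu>. x(k := y) \<in> comm_tuples G k h} = {h}" if "h \<in> carrier G" for h
        using mem that by (auto simp: comm_tuples_def 0 space)
      then show ?thesis
        using measure_point_le[OF close g] g by simp
    next
      case (Suc n)
      \<comment> \<open>The commutator at level \<open>m\<close> reads only the coordinates up to
        \<open>m\<close>, so changing coordinate \<open>k\<close> leaves the inner commutator
        fixed.\<close>
      have "simple_commutator G m (x(k := y)) = simple_commutator G m x" if "m < k" for m y
        using that by (induction m) auto
      then have "{y \<in> space \<mu>. x(k := y) \<in> comm_tuples G k h} =
          {y \<in> carrier G. commutator G (simple_commutator G n x) y = h}" for h
        using mem by (auto simp: comm_tuples_def Suc space)
      moreover have "simple_commutator G n x \<in> carrier G"
        using PiE_mem[OF x] by (intro simple_commutator_closed) (simp add: Suc space)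
      ultimately show ?thesis
        using measure_commutator_fibre_le[OF close] by simp
    qed
  qed
  then show ?thesis
    unfolding comm_prob_def tuple_measure_def J
    by (intro measure_completion_PiM_insert_le prob e def' g one_closed) (auto simp: sets space)
qed

theorem proposition1p7:
  fixes G :: "('a, 'b) monoid_scheme" (structure)
    and k :: nat
    and M :: "nat \<Rightarrow> 'a measure"
  assumes "group G"
    and "\<And>n. group_prob_measure G (M n)"
    and "\<And>n. comm_probs_defined G k (M n)"
    and "measures_index_uniformly G M"
  shows "\<forall>g\<in>carrier G. limsup_comm_prob G k M \<one> \<ge> limsup_comm_prob G k M g"
proof
  fix g assume g: "g \<in> carrier G"
  show "limsup_comm_prob G k M g \<le> limsup_comm_prob G k M \<one>"
  proof (rule ereal_le_epsilon2)
    fix e :: real assume "0 < e"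
    \<comment> \<open>Half of \<open>e\<close> compensates for the factor 2 in
      \<open>comm_prob_le\<close>.\<close>
    then have "0 < e / 2" by simp
    from uniform_limitD[OF assms(4)[unfolded measures_index_uniformly_def] this]
    have "\<forall>\<^sub>F n in sequentially.
        ereal (comm_prob G k (M n) g) \<le> ereal (comm_prob G k (M n) \<one>) + ereal e"
    proof eventually_elim
      case (elim n)
      have "\<bar>measure (M n) (x <# H) - inverse_index G H\<bar> < e / 2"
        if "x \<in> carrier G" "subgroup H G" for x H
        using bspec[OF elim, of "(x, H)"] that by (simp add: dist_real_def)
      from comm_prob_le[OF assms(1-3) this g] show ?case by simp
    qed
    then have "limsup_comm_prob G k M g \<le>
        limsup (\<lambda>n. ereal (comm_prob G k (M n) \<one>) + ereal e)"
      unfolding limsup_comm_prob_def by (rule Limsup_mono)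
    also have "\<dots> = limsup_comm_prob G k M \<one> + ereal e"
      unfolding limsup_comm_prob_def by (intro Limsup_add_ereal_right) auto
    finally show "limsup_comm_prob G k M g \<le> limsup_comm_prob G k M \<one> + ereal e" .
  qed
qed

end
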